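(* Let $n\ge 2$ be an integer and let $D$ be the set of positive divisors of $n$. Let $G=\langle a\rangle$ be a cyclic group of order $n$ and let $S=\{a^{i} : i\in B(1,n)\}$, where $B(1,n)=\{t\in\mathbb{N} : 1\le t\le n,\ \gcd(t,n)=1\}$. Let $X=\{x\in D : p^2\mid x \text{ for some prime } p\}$. Then for every $d\in D$: (1) if $n$ is divisible by the square of a prime, then $M(X_S(G))\ge \max\Big\{\sum_{x\in X}\phi(x),\ \phi(d)\Big\}$; (2) if $n$ is square-free, then $M(X_S(G))\ge \phi(d)$.
   Context: $\phi$ denotes Euler's totient function. For a finite group $G$ and a subset $S\subseteq G$ closed under inverses and not containing the identity, the Cayley graph $X_S(G)$ is the simple undirected graph with vertex set $G$ in which $g_1$ and $g_2$ are adjacent iff $g_1g_2^{-1}\in S$. For a simple graph $\mathcal{G}$ on vertices $u_1,\ldots,u_N$, let $S(\mathcal{G})$ be the set of real symmetric $N\times N$ matrices $A=(a_{ij})$ such that, for all $i\ne j$, $a_{ij}\neq 0$ iff $u_i$ and $u_j$ are adjacent (the diagonal entries are arbitrary). The maximum nullity $M(\mathcal{G})$ is the maximum of the nullities (dimensions of the kernels) of the matrices in $S(\mathcal{G})$. *)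

theory Defs
  imports
    "HOL-Algebra.Generated_Groups"
    "HOL-Number_Theory.Totient"
    "HOL-Computational_Algebra.Squarefree"
    "Graph_Theory.Pair_Digraph"
    "Jordan_Normal_Form.Matrix_Kernel"
begin

text \<open>
  Simple undirected graphs are symmetric loop-free finite digraphs without parallel arcs,
  the locale \<^locale>\<open>pair_graph\<close>.
\<close>

definition cayley_graph :: "('g, 'm) monoid_scheme \<Rightarrow> 'g set \<Rightarrow> 'g pair_pre_digraph" where
  "cayley_graph G S =
     \<lparr> pverts = carrier G,
       parcs = {(g1, g2). g1 \<in> carrier G \<and> g2 \<in> carrier G \<and> g1 \<otimes>\<^bsub>G\<^esub> inv\<^bsub>G\<^esub> g2 \<in> S} \<rparr>"

lemma pair_graph_cayley_graph:
  assumes "group G" "finite (carrier G)"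
    and S_inv: "\<And>s. s \<in> S \<Longrightarrow> inv\<^bsub>G\<^esub> s \<in> S" and S_one: "\<one>\<^bsub>G\<^esub> \<notin> S"
  shows "pair_graph (cayley_graph G S)"
proof -
  interpret group G by fact
  have sym: "y \<otimes>\<^bsub>G\<^esub> inv\<^bsub>G\<^esub> x \<in> S"
    if "x \<in> carrier G" "y \<in> carrier G" "x \<otimes>\<^bsub>G\<^esub> inv\<^bsub>G\<^esub> y \<in> S" for x y
    using S_inv[OF that(3)] that(1,2) by (simp add: inv_mult_group)
  have "finite (parcs (cayley_graph G S))"
    by (rule finite_subset[of _ "carrier G \<times> carrier G"])
       (use assms(2) in \<open>auto simp: cayley_graph_def\<close>)
  then show ?thesis
    using assms(2) S_one
    by unfold_locales (auto simp: cayley_graph_def symmetric_def intro!: symI sym)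
qed

text \<open>
  The vertices of a graph come without an order, so the rows and columns of a matrix are
  matched with them through an enumeration \<open>us\<close> that lists every vertex exactly once.
\<close>

definition graph_matrices :: "'v pair_pre_digraph \<Rightarrow> 'v list \<Rightarrow> real mat set" where
  "graph_matrices \<G> us =
     {A \<in> carrier_mat (length us) (length us).
        transpose_mat A = A \<and>
        (\<forall>i < length us. \<forall>j < length us. i \<noteq> j \<longrightarrow>
           (A $$ (i, j) \<noteq> 0 \<longleftrightarrow> (us ! i, us ! j) \<in> parcs \<G>))}"

text \<open>
  Changing the enumeration permutes rows and columns simultaneously, which preserves nullity;
  letting \<open>us\<close> range over all enumerations is therefore the same as fixing one.
\<close>

definition nullities :: "'v pair_pre_digraph \<Rightarrow> nat set" where
  "nullities \<G> =
     {kernel_dim A | A us. distinct us \<and> set us = pverts \<G> \<and> A \<in> graph_matrices \<G> us}"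

definition max_nullity :: "'v pair_pre_digraph \<Rightarrow> nat" where
  "max_nullity \<G> = Max (nullities \<G>)"

lemma finite_nullities: "finite (nullities \<G>)"
proof (rule finite_subset)
  show "nullities \<G> \<subseteq> {..card (pverts \<G>)}"
  proof
    fix k assume "k \<in> nullities \<G>"
    then obtain A us where k: "k = kernel_dim A" and us: "distinct us" "set us = pverts \<G>"
      and A: "A \<in> graph_matrices \<G> us" by (auto simp: nullities_def)
    have "k \<le> dim_col A" by (simp add: k kernel_dim_code)
    also have "\<dots> = card (pverts \<G>)"
      using A distinct_card[OF us(1)] us(2) by (auto simp: graph_matrices_def)
    finally show "k \<in> {..card (pverts \<G>)}" by simp
  qed
qed simp

lemma nullities_nonempty:
  assumes "pair_graph \<G>"
  shows "nullities \<G> \<noteq> {}"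
proof -
  interpret pair_graph \<G> by fact
  obtain us where us: "distinct us" "set us = pverts \<G>"
    using finite_distinct_list[OF pair_finite_verts] by auto
  let ?A = "mat (length us) (length us)
    (\<lambda>(i, j). if (us ! i, us ! j) \<in> parcs \<G> then 1 else 0 :: real)"
  have "(v, u) \<in> parcs \<G>" if "(u, v) \<in> parcs \<G>" for u v
    using pair_sym_arcs that by (auto simp: symmetric_def dest: symD)
  then have "?A \<in> graph_matrices \<G> us"
    by (auto simp: graph_matrices_def intro!: eq_matI)
  then show ?thesis using us by (auto simp: nullities_def)
qed

end

theory Submission
  imports Defs "HOL-Algebra.Multiplicative_Group"
begin

text \<open>
  Up to its free constant diagonal, the adjacency matrix has entry
  \<open>\<Prod>p. [i \<noteq> j mod p]\<close> at \<open>(i, j)\<close>, over the primes \<open>p\<close> dividing \<open>n\<close>; so its columns depend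
  only on the index modulo the radical \<open>r\<close> of \<open>n\<close>, and its nullity is at least \<open>n - r\<close>. Since
  \<open>r\<close> is the sum of \<open>\<phi>(x)\<close> over the square-free divisors \<open>x\<close> of \<open>n\<close>, this is the sum over \<open>X\<close>.
  It dominates \<open>\<phi>(n)\<close>, hence every \<open>\<phi>(d)\<close>, as soon as \<open>n \<in> X\<close>.
  If \<open>n\<close> is square-free with \<open>k\<close> prime factors, the Chinese remainder theorem makes the matrix
  a tensor product of the matrices \<open>J - I\<close> of size \<open>p\<close>, and the tensor products of
  differences of unit vectors \<open>e\<^sub>a - e\<^sub>0\<close> with \<open>a \<noteq> 0 mod p\<close> are \<open>\<phi>(n)\<close> independent
  eigenvectors for the eigenvalue \<open>(-1)\<^sup>k\<close>, which a shift of the diagonal moves to \<open>0\<close>.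
\<close>

section \<open>Linear algebra: a lower bound for the nullity\<close>

text \<open>Coordinate \<open>i\<close> of a vanishing combination isolates the coefficient of
  \<open>v i\<close>, so the family is independent. Both nullity bounds rest on this
  criterion.\<close>

lemma card_le_kernel_dim:
  fixes A :: "'a :: field mat"
  assumes A: "A \<in> carrier_mat nr nc" and I: "I \<subseteq> {..<nc}"
    and ker: "\<And>i. i \<in> I \<Longrightarrow> v i \<in> mat_kernel A"
    and dual: "\<And>i j. i \<in> I \<Longrightarrow> j \<in> I \<Longrightarrow> v i $ j = (if i = j then 1 else 0)"
  shows "card I \<le> kernel_dim A"
proof -
  interpret kernel nr nc A by unfold_locales (rule A)
  have fin: "finite I" using I finite_subset by blast
  have inj: "inj_on v I" by (rule inj_onI) (metis dual zero_neq_one)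
  have sub: "v ` I \<subseteq> mat_kernel A" using ker by auto
  have "\<not> lin_dep (v ` I)"
  proof (rule Ker.finite_lin_indpt2)
    show "finite (v ` I)" using fin by simp
    show "v ` I \<subseteq> mat_kernel A" by (rule sub)
    fix a :: "'a vec \<Rightarrow> 'a"
    assume zero: "lincomb a (v ` I) = 0\<^sub>v nc"
    show "\<forall>x\<in>v ` I. a x = 0"
    proof
      fix x assume "x \<in> v ` I"
      then obtain i where i: "i \<in> I" "x = v i" by auto
      have "0 = lincomb a (v ` I) $ i" using zero i I by auto
      also have "\<dots> = (\<Sum>x\<in>v ` I. a x * x $ i)"
        using i I by (intro lincomb_index sub) auto
      also have "\<dots> = (\<Sum>j\<in>I. a (v j) * v j $ i)" by (simp add: sum.reindex[OF inj])
      also have "\<dots> = (\<Sum>j\<in>I. if j = i then a (v j) else 0)"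
        by (intro sum.cong) (auto simp: dual i)
      also have "\<dots> = a x" using i fin by simp
      finally show "a x = 0" by simp
    qed
  qed
  moreover have "Ker.fin_dim"
    using kernel_basis_exists[OF A] by (auto simp: Ker.fin_dim_def Ker.basis_def)
  ultimately have "card (v ` I) \<le> dim" by (intro Ker.li_le_dim sub)
  then show ?thesis by (simp add: card_image inj)
qed

section \<open>Factoring sums by the Chinese remainder theorem\<close>

lemma sum_mod_mult_coprime:
  fixes f g :: "nat \<Rightarrow> 'a :: comm_semiring_1"
  assumes "coprime m k" "m > 0" "k > 0"
  shows "(\<Sum>j<m * k. f (j mod m) * g (j mod k)) = (\<Sum>r<m. f r) * (\<Sum>s<k. g s)"
proof -
  let ?h = "\<lambda>j. (j mod m, j mod k)"
  have inj: "inj_on ?h {..<m * k}"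
  proof (rule inj_onI)
    fix x y assume xy: "x \<in> {..<m * k}" "y \<in> {..<m * k}" and eq: "?h x = ?h y"
    have "[x = y] (mod m * k)"
      using eq assms by (intro coprime_cong_mult_nat) (auto simp: cong_def)
    then show "x = y" using xy by (simp add: cong_less_modulus_unique_nat)
  qed
  \<comment> \<open>Surjectivity comes from counting: an injective image of \<open>m * k\<close>
    points fills a set of that size.\<close>
  moreover have "?h ` {..<m * k} = {..<m} \<times> {..<k}"
    using assms by (intro card_subset_eq) (auto simp: card_image inj)
  ultimately have "bij_betw ?h {..<m * k} ({..<m} \<times> {..<k})" by (simp add: bij_betw_def)
  from sum.reindex_bij_betw[OF this, of "\<lambda>(r, s). f r * g s"]
  show ?thesis by (simp add: sum_product sum.cartesian_product)
qed

text \<open>Peels off one modulus at a time. This is how a tensor product of matrices, applied to a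
  tensor product of vectors, splits into its factors.\<close>

lemma sum_prod_mod:
  fixes F :: "nat \<Rightarrow> nat \<Rightarrow> 'a :: comm_semiring_1"
  assumes "finite P" "0 \<notin> P" "\<And>p q. p \<in> P \<Longrightarrow> q \<in> P \<Longrightarrow> p \<noteq> q \<Longrightarrow> coprime p q"
  shows "(\<Sum>j<\<Prod>P. \<Prod>p\<in>P. F p (j mod p)) = (\<Prod>p\<in>P. \<Sum>r<p. F p r)"
  using assms
proof (induction P)
  case (insert p P)
  let ?G = "\<lambda>j. \<Prod>q\<in>P. F q (j mod q)"
  have cop: "coprime p (\<Prod>P)"
    using insert by (intro prod_coprime_right) auto
  \<comment> \<open>Makes the remaining product a function of \<open>j mod \<Prod>P\<close>, the
    shape required by the two-modulus case.\<close>
  have mod: "j mod \<Prod>P mod q = j mod q" if "q \<in> P" for j q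
    using that insert.hyps by (intro mod_mod_cancel) (auto intro: dvd_prodI)
  have "(\<Sum>j<\<Prod>(insert p P). \<Prod>q\<in>insert p P. F q (j mod q))
      = (\<Sum>j<p * \<Prod>P. F p (j mod p) * ?G (j mod \<Prod>P))"
    using insert.hyps by (simp add: mod cong: prod.cong)
  also have "\<dots> = (\<Sum>r<p. F p r) * (\<Sum>j<\<Prod>P. ?G j)"
    using insert.prems insert.hyps cop
    by (intro sum_mod_mult_coprime) (auto intro!: prod_pos gr0I)
  also have "\<dots> = (\<Prod>q\<in>insert p P. \<Sum>r<q. F q r)"
    using insert by simp
  finally show ?case .
qed simp

section \<open>Coprimality prime by prime, and the radical\<close>

lemma coprime_diff_iff_mod_neq:
  assumes "n > 0"
  shows "coprime (int i - int j) (int n) \<longleftrightarrow> (\<forall>p\<in>prime_factors n. i mod p \<noteq> j mod p)"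
proof -
  have dvd: "int p dvd int i - int j \<longleftrightarrow> i mod p = j mod p" for p
    by (metis mod_eq_dvd_iff of_nat_eq_iff zmod_int)
  have "coprime (int i - int j) (int n) \<longleftrightarrow> coprime (nat \<bar>int i - int j\<bar>) n"
    by (metis coprime_abs_left_iff coprime_int_iff int_nat_eq abs_ge_zero)
  also have "\<dots> \<longleftrightarrow> (\<forall>p\<in>prime_factors n. \<not> p dvd nat \<bar>int i - int j\<bar>)"
  proof
    show "\<forall>p\<in>prime_factors n. \<not> p dvd nat \<bar>int i - int j\<bar>"
      if "coprime (nat \<bar>int i - int j\<bar>) n"
      using that by (metis coprime_common_divisor in_prime_factors_iff not_prime_unit)
    show "coprime (nat \<bar>int i - int j\<bar>) n"
      if "\<forall>p\<in>prime_factors n. \<not> p dvd nat \<bar>int i - int j\<bar>"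
    proof (rule ccontr)
      assume "\<not> coprime (nat \<bar>int i - int j\<bar>) n"
      then obtain p where p: "prime p" "p dvd gcd (nat \<bar>int i - int j\<bar>) n"
        using prime_factor_nat[of "gcd (nat \<bar>int i - int j\<bar>) n"]
        by (auto simp only: coprime_iff_gcd_eq_1)
      then have "p dvd nat \<bar>int i - int j\<bar>" "p dvd n" by (meson gcd_nat.boundedE)+
      then show False using p(1) that assms by (auto simp: in_prime_factors_iff)
    qed
  qed
  finally show ?thesis by (simp add: dvd)
qed

lemma prod_prime_factors_squarefree:
  assumes "squarefree (n :: nat)"
  shows "\<Prod>(prime_factors n) = n"
proof -
  have "n \<noteq> 0" using assms by (cases "n = 0") auto
  have "(\<Prod>p\<in>prime_factors n. p ^ multiplicity p n) = \<Prod>(prime_factors n)"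
    using assms \<open>n \<noteq> 0\<close> by (intro prod.cong) (auto simp: squarefree_factorial_semiring')
  then show ?thesis using prod_prime_factors[OF \<open>n \<noteq> 0\<close>] by simp
qed

lemma prod_prime_factors_dvd:
  assumes "(n :: nat) > 0"
  shows "\<Prod>(prime_factors n) dvd n"
proof -
  have "\<Prod>(prime_factors n) dvd (\<Prod>p\<in>prime_factors n. p ^ multiplicity p n)"
    by (intro prod_dvd_prod) (auto simp: prime_factors_multiplicity)
  then show ?thesis using prod_prime_factors[of n] assms by simp
qed

text \<open>The square-free divisors of \<open>n\<close> are exactly the divisors of its radical, to
  which Gauss's divisor sum applies.\<close>

lemma sum_totient_squarefree_divisors:
  assumes "n > 0"
  shows "(\<Sum>d | d dvd n \<and> squarefree d. totient d) = \<Prod>(prime_factors n)"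
proof -
  have "squarefree (\<Prod>(prime_factors n))"
    by (intro squarefree_prod_coprime)
       (auto intro: primes_coprime squarefree_prime simp: in_prime_factors_iff)
  moreover have "d dvd \<Prod>(prime_factors n)" if "d dvd n" "squarefree d" for d
  proof -
    have "\<Prod>(prime_factors d) dvd \<Prod>(prime_factors n)"
      using that assms by (intro prod_dvd_prod_subset dvd_prime_factors) auto
    then show ?thesis using prod_prime_factors_squarefree[OF that(2)] by simp
  qed
  ultimately have "{d. d dvd n \<and> squarefree d} = {d. d dvd \<Prod>(prime_factors n)}"
    using prod_prime_factors_dvd[OF assms] by (auto intro: squarefree_mono dvd_trans)
  then show ?thesis using totient_divisor_sum[of "\<Prod>(prime_factors n)"] by simp
qed

section \<open>The matrix and its nullity\<close>

text \<open>The parameter \<open>c\<close> exploits the freedom of the diagonal in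
  \<open>graph_matrices\<close>. The difference is taken in \<open>int\<close> because subtraction
  on \<open>nat\<close> truncates.\<close>

definition unitary_cayley_mat :: "nat \<Rightarrow> real \<Rightarrow> real mat" where
  "unitary_cayley_mat n c = mat n n (\<lambda>(i, j).
     if i = j then c else if coprime (int i - int j) (int n) then 1 else 0)"

lemma unitary_cayley_mat_carrier [simp]: "unitary_cayley_mat n c \<in> carrier_mat n n"
  by (simp add: unitary_cayley_mat_def)

text \<open>As \<open>n \<ge> 2\<close> has a prime factor, the product vanishes on the diagonal,
  where only \<open>c\<close> remains.\<close>

lemma unitary_cayley_mat_index:
  assumes "n \<ge> 2" "i < n" "j < n"
  shows "unitary_cayley_mat n c $$ (i, j) =
    (\<Prod>p\<in>prime_factors n. of_bool (i mod p \<noteq> j mod p)) + c * of_bool (i = j)"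
proof -
  have "(\<Prod>p\<in>prime_factors n. of_bool (i mod p \<noteq> j mod p) :: real)
      = of_bool (coprime (int i - int j) (int n))"
    using assms(1) by (subst coprime_diff_iff_mod_neq) (auto simp: prod_zero_iff)
  then show ?thesis using assms by (auto simp: unitary_cayley_mat_def)
qed

text \<open>The product of the \<open>- 1\<close> is the eigenvalue of the zero-diagonal matrix; its
  negative on the diagonal turns eigenvectors into kernel vectors.\<close>

lemma totient_le_kernel_dim_unitary_cayley_mat:
  assumes n: "n \<ge> 2" and sf: "squarefree n"
  shows "totient n \<le> kernel_dim (unitary_cayley_mat n (- (\<Prod>p\<in>prime_factors n. - 1)))"
proof -
  let ?P = "prime_factors n"
  let ?M = "unitary_cayley_mat n (- (\<Prod>p\<in>?P. - 1))"
  \<comment> \<open>\<open>f a\<close> is the tensor product, over the primes \<open>p\<close>, of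
    the differences of unit vectors at \<open>a mod p\<close> and \<open>0\<close>.\<close>
  define f :: "nat \<Rightarrow> nat \<Rightarrow> real" where
    "f a j = (\<Prod>p\<in>?P. of_bool (j mod p = a mod p) - of_bool (j mod p = 0))" for a j
  have prod: "\<Prod>?P = n" using sf by (rule prod_prime_factors_squarefree)
  have crt: "(\<Sum>j<n. \<Prod>p\<in>?P. F p (j mod p)) = (\<Prod>p\<in>?P. \<Sum>r<p. F p r)"
    for F :: "nat \<Rightarrow> nat \<Rightarrow> real"
    using sum_prod_mod[of ?P F] by (auto simp: prod in_prime_factors_iff primes_coprime)
  have eigen: "(\<Sum>j<n. (\<Prod>p\<in>?P. of_bool (i mod p \<noteq> j mod p)) * f a j) = (\<Prod>p\<in>?P. - 1) * f a i"
    for i a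
  proof -
    have "(\<Sum>j<n. (\<Prod>p\<in>?P. of_bool (i mod p \<noteq> j mod p)) * f a j)
      = (\<Sum>j<n. \<Prod>p\<in>?P. of_bool (i mod p \<noteq> j mod p) *
           (of_bool (j mod p = a mod p) - of_bool (j mod p = 0)))"
      by (simp add: f_def prod.distrib)
    also have "\<dots> = (\<Prod>p\<in>?P. \<Sum>r<p. of_bool (i mod p \<noteq> r) *
           (of_bool (r = a mod p) - of_bool (r = 0)))"
      by (rule crt)
    \<comment> \<open>In each factor the all-ones matrix kills a difference of unit vectors, so
      \<open>J - I\<close> acts as \<open>- 1\<close>.\<close>
    also have "\<dots> = (\<Prod>p\<in>?P. - 1 * (of_bool (i mod p = a mod p) - of_bool (i mod p = 0)))"
    proof (intro prod.cong refl)
      fix p assume "p \<in> ?P"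
      then have p: "p > 0" by (auto simp: in_prime_factors_iff prime_gt_0_nat)
      have "(\<Sum>r<p. of_bool (i mod p \<noteq> r) * (of_bool (r = a mod p) - of_bool (r = 0)) :: real)
         = (\<Sum>r<p. if r = a mod p then of_bool (i mod p \<noteq> r) else 0)
           - (\<Sum>r<p. if r = 0 then of_bool (i mod p \<noteq> r) else 0)"
        by (subst sum_subtractf[symmetric]) (intro sum.cong, auto)
      also have "\<dots> = of_bool (i mod p \<noteq> a mod p) - of_bool (i mod p \<noteq> 0)"
        using p by simp
      finally show "(\<Sum>r<p. of_bool (i mod p \<noteq> r) * (of_bool (r = a mod p) - of_bool (r = 0)) :: real)
         = - 1 * (of_bool (i mod p = a mod p) - of_bool (i mod p = 0))" by simp
    qed
    also have "\<dots> = (\<Prod>p\<in>?P. - 1) * f a i" by (simp only: f_def prod.distrib)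
    finally show ?thesis .
  qed
  have dual: "f a b = (if a = b then 1 else 0)" if a: "a \<in> totatives n" and b: "b \<in> totatives n" for a b
  proof -
    \<comment> \<open>A totative has no zero residue, so the subtracted indicators drop out and
      \<open>f a b\<close> only compares residues.\<close>
    have "b mod p \<noteq> 0" if "p \<in> ?P" for p
      using b that by (metis coprime_common_divisor mod_0_imp_dvd in_prime_factors_iff
        in_totatives_iff not_prime_unit)
    then have "f a b = (\<Prod>p\<in>?P. of_bool (b mod p = a mod p))"
      unfolding f_def by (intro prod.cong) auto
    moreover have "a = b" if "\<And>p. p \<in> ?P \<Longrightarrow> b mod p = a mod p"
    proof -
      have "[b = a] (mod (\<Prod>p\<in>?P. p))"
        using that by (intro coprime_cong_prod_nat) (auto simp: cong_def in_prime_factors_iff primes_coprime)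
      then show ?thesis
        using a b n by (auto simp: prod cong_def totatives_less)
    qed
    ultimately show ?thesis by (auto simp: prod_zero_iff)
  qed
  have "vec n (f a) \<in> mat_kernel ?M" for a
  proof (rule mat_kernelI[of _ n n])
    show "?M *\<^sub>v vec n (f a) = 0\<^sub>v n"
    proof (rule eq_vecI)
      fix i assume "i < dim_vec (0\<^sub>v n)"
      then have i: "i < n" by simp
      have "(?M *\<^sub>v vec n (f a)) $ i = (\<Sum>j<n. ?M $$ (i, j) * f a j)"
        using i by (simp add: scalar_prod_def unitary_cayley_mat_def lessThan_atLeast0)
      also have "\<dots> = (\<Sum>j<n. (\<Prod>p\<in>?P. of_bool (i mod p \<noteq> j mod p)) * f a j
          + (if j = i then - (\<Prod>p\<in>?P. - 1) * f a j else 0))"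
        using i n by (intro sum.cong) (auto simp: unitary_cayley_mat_index algebra_simps)
      also have "\<dots> = 0" using i by (simp only: sum.distrib eigen) simp
      finally show "(?M *\<^sub>v vec n (f a)) $ i = 0\<^sub>v n $ i" using i by simp
    qed (simp add: unitary_cayley_mat_def)
  qed auto
  moreover have "totatives n \<subseteq> {..<n}" using n by (auto simp: totatives_less)
  ultimately have "card (totatives n) \<le> kernel_dim ?M"
    by (intro card_le_kernel_dim[of _ n n _ "\<lambda>a. vec n (f a)"]) (auto simp: dual)
  then show ?thesis by (simp add: totient_def)
qed

text \<open>With diagonal \<open>0\<close> the product formula holds for every entry, so columns
  \<open>j\<close> and \<open>j mod r\<close> agree and the difference of their unit vectors is in
  the kernel.\<close>

lemma diff_radical_le_kernel_dim_unitary_cayley_mat: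
  assumes n: "n \<ge> 2"
  shows "n - \<Prod>(prime_factors n) \<le> kernel_dim (unitary_cayley_mat n 0)"
proof -
  define r where "r = \<Prod>(prime_factors n)"
  let ?M = "unitary_cayley_mat n 0"
  have r: "r > 0" unfolding r_def
    by (intro prod_pos) (auto simp: in_prime_factors_iff prime_gt_0_nat)
  have mod: "j mod r mod p = j mod p" if "p \<in> prime_factors n" for j p
    unfolding r_def using that by (intro mod_mod_cancel) (auto intro: dvd_prodI)
  have "unit_vec n j - unit_vec n (j mod r) \<in> mat_kernel ?M" if "j \<in> {r..<n}" for j
  proof (rule mat_kernelI[of _ n n])
    have j: "j < n" "j mod r < n" using that r by (auto intro: le_less_trans[OF mod_less_eq_dividend])
    show "?M *\<^sub>v (unit_vec n j - unit_vec n (j mod r)) = 0\<^sub>v n"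
    proof (rule eq_vecI)
      fix i assume "i < dim_vec (0\<^sub>v n)"
      then have i: "i < n" by simp
      have row: "row ?M i \<in> carrier_vec n" by (rule row_carrier_vec[OF i]) simp
      have "(?M *\<^sub>v (unit_vec n j - unit_vec n (j mod r))) $ i
          = row ?M i \<bullet> (unit_vec n j - unit_vec n (j mod r))"
        using i by (simp add: unitary_cayley_mat_def)
      also have "\<dots> = row ?M i $ j - row ?M i $ (j mod r)"
        using row j by (simp add: scalar_prod_minus_distrib[of _ n])
      also have "\<dots> = ?M $$ (i, j) - ?M $$ (i, j mod r)"
        using i j by (simp add: unitary_cayley_mat_def)
      also have "\<dots> = 0"
        using i j n by (simp add: unitary_cayley_mat_index mod cong: prod.cong)
      finally show "(?M *\<^sub>v (unit_vec n j - unit_vec n (j mod r))) $ i = 0\<^sub>v n $ i"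
        using i by simp
    qed (simp add: unitary_cayley_mat_def)
  qed auto
  \<comment> \<open>The subtracted unit vector sits at an index below \<open>r\<close>, outside the
    tested coordinates.\<close>
  moreover have "(unit_vec n i - unit_vec n (i mod r) :: real vec) $ j = (if i = j then 1 else 0)"
    if "i \<in> {r..<n}" "j \<in> {r..<n}" for i j
    using that mod_less_divisor[OF r, of i] by auto
  ultimately have "card {r..<n} \<le> kernel_dim ?M"
    by (intro card_le_kernel_dim[of _ n n _ "\<lambda>j. unit_vec n j - unit_vec n (j mod r)"]) auto
  then show ?thesis by (simp add: r_def)
qed

section \<open>From the matrix to the Cayley graph\<close>

text \<open>Enumerating the group as \<open>a [^] 0\<close>, ..., \<open>a [^] (n - 1)\<close> makes
  adjacency a condition on the difference of exponents.\<close>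

lemma kernel_dim_unitary_cayley_mat_le_max_nullity:
  fixes G :: "('g, 'm) monoid_scheme" (structure)
  assumes n: "n \<ge> 2"
    and "group G" and a: "a \<in> carrier G" and gen: "carrier G = generate G {a}"
    and ord: "Coset.order G = n"
    and S: "S = {a [^]\<^bsub>G\<^esub> i | i :: nat. 1 \<le> i \<and> i \<le> n \<and> gcd i n = 1}"
  shows "kernel_dim (unitary_cayley_mat n c) \<le> max_nullity (cayley_graph G S)"
proof -
  interpret group G by fact
  have orda: "ord a = n"
    using generate_pow_card[OF a] ord gen by (simp add: Coset.order_def)
  have fin: "finite (carrier G)" using ord n by (simp add: Coset.order_def card_ge_0_finite)
  define us where "us = map (\<lambda>i. a [^] i) [0..<n]"
  have len: "length us = n" by (simp add: us_def)
  have nth: "us ! i = a [^] i" if "i < n" for i using that by (simp add: us_def)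
  have eq_iff: "a [^] x = a [^] y \<longleftrightarrow> [x = y] (mod int n)" for x y :: int
    using int_pow_eq[OF a, of y x] orda by (auto simp: cong_iff_dvd_diff)
  have "i = j" if "i < n" "j < n" "a [^] i = a [^] j" for i j :: nat
  proof -
    have "[int i = int j] (mod int n)"
      using that eq_iff[of "int i" "int j"] by (simp add: int_pow_int)
    then show "i = j" using that by (simp add: cong_int_iff cong_less_modulus_unique_nat)
  qed
  then have dist: "distinct us"
    by (auto simp: us_def distinct_map intro!: inj_onI)
  have verts: "set us = carrier G"
  proof (rule card_subset_eq[OF fin])
    show "set us \<subseteq> carrier G" using a by (auto simp: us_def)
    show "card (set us) = card (carrier G)"
      using distinct_card[OF dist] ord len by (simp add: Coset.order_def)
  qed
  have adj: "(a [^] i, a [^] j) \<in> parcs (cayley_graph G S) \<longleftrightarrow> coprime (int i - int j) (int n)"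
    for i j :: nat
  proof -
    have "a [^] i \<otimes> inv (a [^] j) = a [^] (int i - int j)"
      using a by (simp add: int_pow_diff int_pow_int)
    then have "(a [^] i, a [^] j) \<in> parcs (cayley_graph G S) \<longleftrightarrow>
        (\<exists>t::nat. a [^] (int i - int j) = a [^] int t \<and> 1 \<le> t \<and> t \<le> n \<and> gcd t n = 1)"
      using a by (auto simp: cayley_graph_def S int_pow_int)
    also have "\<dots> \<longleftrightarrow> coprime (int i - int j) (int n)"
    proof (intro iffI; (elim exE conjE)?)
      fix t :: nat assume "a [^] (int i - int j) = a [^] int t" and t: "gcd t n = 1"
      then have "[int t = int i - int j] (mod int n)" by (simp add: eq_iff cong_sym_eq)
      moreover have "coprime (int t) (int n)" using t by (simp add: coprime_iff_gcd_eq_1)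
      ultimately show "coprime (int i - int j) (int n)" by (rule cong_imp_coprime)
    next
      assume cop: "coprime (int i - int j) (int n)"
      define t where "t = nat ((int i - int j) mod int n)"
      have t: "int t = (int i - int j) mod int n" using n by (simp add: t_def)
      have c: "[int i - int j = int t] (mod int n)" by (simp add: t cong_def)
      have "coprime (int t) (int n)" using cop cong_imp_coprime[OF c] by simp
      then have cop_t: "coprime t n" by simp
      \<comment> \<open>Since \<open>gcd 0 n = n \<ge> 2\<close>, the residue \<open>t\<close>
        avoids \<open>0\<close> and so lies in the exponent range of \<open>S\<close>, which starts
        at 1.\<close>
      have "t \<noteq> 0" using cop_t n by (cases "t = 0") auto
      moreover have "t < n" using n by (simp add: t_def nat_less_iff)
      moreover have "a [^] (int i - int j) = a [^] int t" using c by (simp only: eq_iff)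
      ultimately show "\<exists>t::nat. a [^] (int i - int j) = a [^] int t \<and> 1 \<le> t \<and> t \<le> n \<and> gcd t n = 1"
        using cop_t by (intro exI[of _ t]) auto
    qed
    finally show ?thesis .
  qed
  have sym: "coprime (int i - int j) (int n) \<longleftrightarrow> coprime (int j - int i) (int n)" for i j
    by (metis coprime_minus_left_iff minus_diff_eq)
  have "unitary_cayley_mat n c \<in> graph_matrices (cayley_graph G S) us"
    unfolding graph_matrices_def len
    by (auto simp: nth adj unitary_cayley_mat_def sym intro!: eq_matI)
  then have "kernel_dim (unitary_cayley_mat n c) \<in> nullities (cayley_graph G S)"
    using dist verts by (auto simp: nullities_def cayley_graph_def)
  then show ?thesis unfolding max_nullity_def by (intro Max_ge finite_nullities)
qed

theorem corollary3p3:
  fixes G :: "('g, 'm) monoid_scheme" and a :: 'g and n :: nat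
    and D X :: "nat set" and S :: "'g set"
  assumes "n \<ge> 2"
    and "group G" and "a \<in> carrier G" and "carrier G = generate G {a}" and "Coset.order G = n"
    and "D = {x. x > 0 \<and> x dvd n}"
    and "S = {a [^]\<^bsub>G\<^esub> i | i :: nat. 1 \<le> i \<and> i \<le> n \<and> gcd i n = 1}"
    and "X = {x \<in> D. \<exists>p. prime p \<and> p\<^sup>2 dvd x}"
  shows "\<forall>d \<in> D.
    ((\<exists>p. prime p \<and> p\<^sup>2 dvd n) \<longrightarrow>
       max_nullity (cayley_graph G S) \<ge> max (\<Sum>x\<in>X. totient x) (totient d)) \<and>
    (squarefree n \<longrightarrow> max_nullity (cayley_graph G S) \<ge> totient d)"
proof (intro ballI conjI impI)
  let ?\<nu> = "max_nullity (cayley_graph G S)"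
  note nullity = kernel_dim_unitary_cayley_mat_le_max_nullity[OF assms(1-5,7)]
  fix d assume "d \<in> D"
  \<comment> \<open>\<open>totient d\<close> divides \<open>totient n\<close>, so it suffices to
    treat \<open>d = n\<close>.\<close>
  then have d: "totient d \<le> totient n"
    using assms(1,6) by (intro dvd_imp_le totient_dvd) auto
  show "?\<nu> \<ge> totient d" if "squarefree n"
    by (rule order_trans[OF d order_trans[OF totient_le_kernel_dim_unitary_cayley_mat nullity]])
       (use assms(1) that in auto)
  assume nsf: "\<exists>p. prime p \<and> p\<^sup>2 dvd n"
  have X: "X = {x. x dvd n} - {x. x dvd n \<and> squarefree x}"
  proof -
    have "squarefree x \<longleftrightarrow> \<not> (\<exists>p. prime p \<and> p\<^sup>2 dvd x)" "x > 0" if "x dvd n" for x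
    proof -
      show "x > 0" using that assms(1) by (auto intro: gr0I)
      then show "squarefree x \<longleftrightarrow> \<not> (\<exists>p. prime p \<and> p\<^sup>2 dvd x)"
        using squarefree_factorial_semiring[of x] by simp
    qed
    then show ?thesis unfolding assms(6,8) by blast
  qed
  have finD: "finite {x. x dvd n}" using assms(1) by simp
  \<comment> \<open>The totients of all divisors sum to \<open>n\<close>, those of the square-free
    ones to the radical.\<close>
  have "(\<Sum>x\<in>X. totient x) = n - \<Prod>(prime_factors n)"
    using assms(1) finD sum_totient_squarefree_divisors[of n] totient_divisor_sum[of n]
    unfolding X by (subst sum_diff_nat) auto
  then have sum: "(\<Sum>x\<in>X. totient x) \<le> ?\<nu>"
    using diff_radical_le_kernel_dim_unitary_cayley_mat[OF assms(1)] nullity[of 0] by simp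
  have "n \<in> X" using nsf assms(1) by (auto simp: assms(6,8))
  then have "totient n \<le> (\<Sum>x\<in>X. totient x)"
    using finD by (intro member_le_sum) (auto simp: X)
  then show "?\<nu> \<ge> max (\<Sum>x\<in>X. totient x) (totient d)" using sum d by simp
qed

end
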